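(* Let $k\in\mathbb{N}_0$ and let $(F_i)_{i\in I}$ be an acyclic finite family of clause-sets. If $F_i\in\mathcal{PC}_k$ for all $i\in I$, then $\bigcup_{i\in I}F_i\in\mathcal{PC}_k$.
   Context: Literals, clauses (finite sets of literals without complementary pairs), clause-sets (finite sets of clauses); $\bot$ empty clause; $\mathrm{var}$. Partial assignments $\varphi$ and $\varphi*F$ (delete clauses containing a true literal, delete false literals). A literal $x$ is forced for $F$ if $\langle x\to0\rangle*F$ is unsatisfiable. Generalised unit propagation: $r_0(F)=\{\bot\}$ if $\bot\in F$ and $F$ otherwise; $r_{k+1}(F)=\{\bot\}$ if $r_k(F)=\{\bot\}$, else if some literal $x$ has $r_k(\langle x\to0\rangle*F)=\{\bot\}$ then $r_{k+1}(F)=r_{k+1}(\langle x\to1\rangle*F)$, else $r_{k+1}(F)=F$. $r_\infty(F)$ is $\{\bot\}$ if $F$ is unsatisfiable and otherwise the result of applying all forced assignments. $\mathcal{PC}_k$ is the class of clause-sets $F$ such that $r_k(\varphi*F)=r_\infty(\varphi*F)$ for all partial assignments $\varphi$. Incidence graph of $(F_i)_{i\in I}$: bipartite graph with parts $\bigcup_{i}\mathrm{var}(F_i)$ and $I$, $v$ adjacent to $i$ iff $v\in\mathrm{var}(F_i)$; the family is acyclic if this graph has no cycle. *)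

theory Defs
  imports Main
begin

datatype 'v literal = Pos (var_of: 'v) | Neg (var_of: 'v)

primrec compl :: "'v literal \<Rightarrow> 'v literal" where
  "compl (Pos v) = Neg v"
| "compl (Neg v) = Pos v"

type_synonym 'v clause = "'v literal set"

definition is_clause :: "'v clause \<Rightarrow> bool" where
  "is_clause C \<longleftrightarrow> finite C \<and> (\<forall>x\<in>C. compl x \<notin> C)"

definition is_clause_set :: "'v clause set \<Rightarrow> bool" where
  "is_clause_set F \<longleftrightarrow> finite F \<and> (\<forall>C\<in>F. is_clause C)"

definition vars :: "'v clause set \<Rightarrow> 'v set" where
  "vars F = var_of ` \<Union>F"

definition is_passign :: "('v \<rightharpoonup> bool) \<Rightarrow> bool" where
  "is_passign \<phi> \<longleftrightarrow> finite (dom \<phi>)"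

primrec lit_val :: "('v \<rightharpoonup> bool) \<Rightarrow> 'v literal \<Rightarrow> bool option" where
  "lit_val \<phi> (Pos v) = \<phi> v"
| "lit_val \<phi> (Neg v) = map_option Not (\<phi> v)"

definition apply_pa :: "('v \<rightharpoonup> bool) \<Rightarrow> 'v clause set \<Rightarrow> 'v clause set"  (infixr "\<star>" 75) where
  "\<phi> \<star> F = {{x \<in> C. lit_val \<phi> x \<noteq> Some False} | C. C \<in> F \<and> (\<forall>x\<in>C. lit_val \<phi> x \<noteq> Some True)}"

primrec set_lit :: "'v literal \<Rightarrow> bool \<Rightarrow> ('v \<rightharpoonup> bool)" where
  "set_lit (Pos v) b = [v \<mapsto> b]"
| "set_lit (Neg v) b = [v \<mapsto> \<not> b]"

definition satisfiable :: "'v clause set \<Rightarrow> bool" where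
  "satisfiable F \<longleftrightarrow> (\<exists>\<phi>. is_passign \<phi> \<and> \<phi> \<star> F = {})"

definition forced :: "'v clause set \<Rightarrow> 'v literal \<Rightarrow> bool" where
  "forced F x \<longleftrightarrow> \<not> satisfiable (set_lit x False \<star> F)"

text \<open>
  The empty clause is \<open>{}\<close>, so \<open>{{}}\<close> is the clause-set consisting of the empty clause only.

  In the step from \<open>r\<^sub>k\<close> (the parameter \<open>R\<close>) to \<open>r\<^sub>k\<^sub>+\<^sub>1\<close>, the literal that
  is set to true is an arbitrary one with the required property. If \<open>r\<^sub>k F \<noteq> {{}}\<close>, such a
  literal has its variable in \<open>F\<close>, hence the recursion ends for every finite clause-set; the
  equation is tail-recursive, so no domain restriction is needed to define the function.
\<close>

partial_function (tailrec) gup_step ::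
    "('v clause set \<Rightarrow> 'v clause set) \<Rightarrow> 'v clause set \<Rightarrow> 'v clause set" where
  "gup_step R F =
    (if R F = {{}} then {{}}
     else if \<exists>x. R (set_lit x False \<star> F) = {{}}
     then gup_step R (set_lit (SOME x. R (set_lit x False \<star> F) = {{}}) True \<star> F)
     else F)"

primrec gup :: "nat \<Rightarrow> 'v clause set \<Rightarrow> 'v clause set" where
  "gup 0 = (\<lambda>F. if {} \<in> F then {{}} else F)"
| "gup (Suc k) = gup_step (gup k)"

lemma gup_Suc_unfold:
  "gup (Suc k) F =
    (if gup k F = {{}} then {{}}
     else if \<exists>x. gup k (set_lit x False \<star> F) = {{}}
     then gup (Suc k) (set_lit (SOME x. gup k (set_lit x False \<star> F) = {{}}) True \<star> F)
     else F)"
  unfolding gup.simps by (rule gup_step.simps)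

text \<open>
  If \<open>F\<close> is satisfiable, a literal and its complement are never both forced, so the order
  of the two tests below is irrelevant wherever this assignment is used.
\<close>

definition forced_assignment :: "'v clause set \<Rightarrow> ('v \<rightharpoonup> bool)" where
  "forced_assignment F =
    (\<lambda>v. if forced F (Pos v) then Some True else if forced F (Neg v) then Some False else None)"

definition gup_inf :: "'v clause set \<Rightarrow> 'v clause set" where
  "gup_inf F = (if satisfiable F then forced_assignment F \<star> F else {{}})"

definition PC :: "nat \<Rightarrow> 'v clause set set" where
  "PC k = {F. is_clause_set F \<and> (\<forall>\<phi>. is_passign \<phi> \<longrightarrow> gup k (\<phi> \<star> F) = gup_inf (\<phi> \<star> F))}"

text \<open>
  Undirected simple graphs are given by a vertex set and a set of two-element edges. A cycle is
  listed by its vertices without repeating the first one, so it has at least three entries.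
\<close>

type_synonym 'a ugraph = "'a set \<times> 'a set set"

definition is_cycle :: "'a ugraph \<Rightarrow> 'a list \<Rightarrow> bool" where
  "is_cycle G p \<longleftrightarrow> 3 \<le> length p \<and> distinct p \<and> set p \<subseteq> fst G \<and>
    (\<forall>j < length p. {p ! j, p ! (Suc j mod length p)} \<in> snd G)"

definition incidence_graph :: "'i set \<Rightarrow> ('i \<Rightarrow> 'v clause set) \<Rightarrow> ('v + 'i) ugraph" where
  "incidence_graph I F =
    (Inl ` (\<Union>i\<in>I. vars (F i)) \<union> Inr ` I,
     {{Inl v, Inr i} | v i. i \<in> I \<and> v \<in> vars (F i)})"

definition acyclic_family :: "'i set \<Rightarrow> ('i \<Rightarrow> 'v clause set) \<Rightarrow> bool" where
  "acyclic_family I F \<longleftrightarrow> (\<nexists>p. is_cycle (incidence_graph I F) p)"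

end

theory Submission
  imports Defs
begin

text \<open>
  Whether \<open>r\<^sub>k F = {{}}\<close> is a matter of derivability in a refutation calculus that is monotone in
  \<open>F\<close> and stable under partial assignments. Hence \<open>F\<close> is in \<open>PC\<^sub>k\<close> iff each \<open>\<phi> \<star> F\<close> on which
  \<open>r\<^sub>k\<close> makes no progress is flexible: every variable takes both values in its models.
  If \<open>r\<^sub>k\<close> makes no progress on a union then, by monotonicity, neither does it on the parts,
  so the parts are flexible. Models of flexible clause-sets that share at most one variable can be
  glued, and an acyclic family always has a member sharing at most one variable with the others.
\<close>

section \<open>Partial assignments and models\<close>

lemma lit_val_map_add:
  "lit_val (\<phi> ++ \<psi>) x = (case lit_val \<psi> x of Some b \<Rightarrow> Some b | None \<Rightarrow> lit_val \<phi> x)"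
  by (cases x) (auto simp: map_add_def split: option.splits)

lemma lit_val_eq_None_iff: "lit_val \<phi> x = None \<longleftrightarrow> \<phi> (var_of x) = None"
  by (cases x) auto

lemma lit_val_cong: "\<phi> (var_of x) = \<psi> (var_of x) \<Longrightarrow> lit_val \<phi> x = lit_val \<psi> x"
  by (cases x) auto

text \<open>The variables assigned by \<open>\<psi>\<close> vanish first, so \<open>\<psi>\<close>
  takes precedence; this matches \<open>++\<close>, whose right operand overrides.\<close>

lemma apply_pa_apply_pa: "\<phi> \<star> (\<psi> \<star> F) = (\<phi> ++ \<psi>) \<star> F"
proof -
  define r where "r \<phi> C = {x \<in> C. lit_val \<phi> x \<noteq> Some False}" for \<phi> and C :: "'a clause"
  define s where "s \<phi> C \<longleftrightarrow> (\<forall>x\<in>C. lit_val \<phi> x \<noteq> Some True)" for \<phi> and C :: "'a clause"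
  have image: "\<phi> \<star> F = r \<phi> ` {C \<in> F. s \<phi> C}" for \<phi> and F :: "'a clause set"
    unfolding apply_pa_def r_def s_def by (simp only: image_Collect)
  have r: "r \<phi> (r \<psi> C) = r (\<phi> ++ \<psi>) C" if "s \<psi> C" for C
    using that by (auto simp: r_def s_def lit_val_map_add split: option.splits)
  have s: "s \<psi> C \<and> s \<phi> (r \<psi> C) \<longleftrightarrow> s (\<phi> ++ \<psi>) C" for C
    by (force simp: r_def s_def lit_val_map_add split: option.splits)
  have "\<phi> \<star> (\<psi> \<star> F) = (\<lambda>C. r \<phi> (r \<psi> C)) ` {C \<in> F. s \<psi> C \<and> s \<phi> (r \<psi> C)}"
    unfolding image by blast
  also have "\<dots> = (\<lambda>C. r (\<phi> ++ \<psi>) C) ` {C \<in> F. s (\<phi> ++ \<psi>) C}"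
    by (rule image_cong) (use r s in blast)+
  finally show ?thesis
    unfolding image .
qed

lemma apply_pa_mono: "F \<subseteq> G \<Longrightarrow> \<phi> \<star> F \<subseteq> \<phi> \<star> G"
  unfolding apply_pa_def by blast

lemma apply_pa_UN: "\<phi> \<star> (\<Union>i\<in>I. F i) = (\<Union>i\<in>I. \<phi> \<star> F i)"
  unfolding apply_pa_def by blast

lemma empty_clause_in_apply_pa: "{} \<in> F \<Longrightarrow> {} \<in> \<phi> \<star> F"
  unfolding apply_pa_def by force

lemma apply_pa_eq_empty_iff: "\<phi> \<star> F = {} \<longleftrightarrow> (\<forall>C\<in>F. \<exists>x\<in>C. lit_val \<phi> x = Some True)"
  unfolding apply_pa_def by blast

lemma vars_apply_pa: "vars (\<phi> \<star> F) \<subseteq> vars F - dom \<phi>"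
proof
  fix v assume "v \<in> vars (\<phi> \<star> F)"
  then obtain C x where *: "C \<in> F" "\<forall>y\<in>C. lit_val \<phi> y \<noteq> Some True"
    "x \<in> C" "lit_val \<phi> x \<noteq> Some False" "v = var_of x"
    unfolding vars_def apply_pa_def by blast
  then have "lit_val \<phi> x = None"
    by (metis (full_types) not_None_eq)
  with * show "v \<in> vars F - dom \<phi>"
    unfolding vars_def by (auto simp: lit_val_eq_None_iff)
qed

lemma apply_pa_disjoint:
  assumes "dom \<phi> \<inter> vars F = {}"
  shows "\<phi> \<star> F = F"
proof -
  have "lit_val \<phi> x = None" if "C \<in> F" "x \<in> C" for C x
    using assms that unfolding vars_def lit_val_eq_None_iff by blast
  then have "{x \<in> C. lit_val \<phi> x \<noteq> Some False} = C" "\<forall>x\<in>C. lit_val \<phi> x \<noteq> Some True"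
    if "C \<in> F" for C
    using that by auto
  then show ?thesis
    unfolding apply_pa_def by (intro equalityI subsetI CollectI) force+
qed

lemma vars_UN: "vars (\<Union>i\<in>I. F i) = (\<Union>i\<in>I. vars (F i))"
  unfolding vars_def by blast

lemma finite_vars: "is_clause_set F \<Longrightarrow> finite (vars F)"
  unfolding is_clause_set_def is_clause_def vars_def by simp

section \<open>Literals as assignments of a single variable\<close>

lemma set_lit_cases:
  obtains v b where "set_lit x False = [v \<mapsto> b]" "set_lit x True = [v \<mapsto> \<not> b]"
  by (cases x) auto

lemma ex_set_lit_False_iff: "(\<exists>x. P (set_lit x False)) \<longleftrightarrow> (\<exists>v b. P [v \<mapsto> b])"
proof
  assume "\<exists>x. P (set_lit x False)"
  then obtain x where "P (set_lit x False)" ..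
  then show "\<exists>v b. P [v \<mapsto> b]"
    by (cases x) auto
next
  assume "\<exists>v b. P [v \<mapsto> b]"
  then obtain v b where "P [v \<mapsto> b]" by blast
  then have "P (set_lit (if b then Neg v else Pos v) False)"
    by (cases b) simp_all
  then show "\<exists>x. P (set_lit x False)" ..
qed

text \<open>Total assignments avoid bookkeeping of domains. \<open>Some \<circ> \<alpha>\<close> may
  have an infinite domain and then violates \<open>is_passign\<close>;
  \<open>satisfiable_iff_models\<close> bridges the gap.\<close>

definition models :: "('v \<Rightarrow> bool) \<Rightarrow> 'v clause set \<Rightarrow> bool" where
  "models \<alpha> F \<longleftrightarrow> (Some \<circ> \<alpha>) \<star> F = {}"

lemma models_UN: "models \<alpha> (\<Union>i\<in>I. F i) \<longleftrightarrow> (\<forall>i\<in>I. models \<alpha> (F i))"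
  unfolding models_def apply_pa_UN by blast

lemma models_cong:
  assumes "\<And>v. v \<in> vars F \<Longrightarrow> \<alpha> v = \<beta> v"
  shows "models \<alpha> F \<longleftrightarrow> models \<beta> F"
proof -
  have "lit_val (Some \<circ> \<alpha>) x = lit_val (Some \<circ> \<beta>) x" if "C \<in> F" "x \<in> C" for C x
    by (rule lit_val_cong) (use assms that in \<open>auto simp: vars_def\<close>)
  then show ?thesis
    unfolding models_def apply_pa_eq_empty_iff by auto
qed

lemma models_assign: "models \<alpha> ([v \<mapsto> b] \<star> F) \<longleftrightarrow> models (\<alpha>(v := b)) F"
proof -
  have "(Some \<circ> \<alpha>) ++ [v \<mapsto> b] = Some \<circ> \<alpha>(v := b)"
    by auto
  then show ?thesis
    unfolding models_def apply_pa_apply_pa by simp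
qed

lemma not_models_empty_clause: "{} \<in> F \<Longrightarrow> \<not> models \<alpha> F"
  using empty_clause_in_apply_pa unfolding models_def by blast

text \<open>A satisfying partial assignment is extended by the default \<open>False\<close>;
  conversely, a model is restricted to \<open>vars F\<close>, whose finiteness makes the restriction
  a partial assignment.\<close>

lemma satisfiable_iff_models:
  assumes "finite (vars F)"
  shows "satisfiable F \<longleftrightarrow> (\<exists>\<alpha>. models \<alpha> F)"
proof
  assume "satisfiable F"
  then obtain \<phi> where \<phi>: "\<phi> \<star> F = {}"
    unfolding satisfiable_def by blast
  define \<alpha> where "\<alpha> v = (\<phi> v = Some True)" for v
  have "lit_val (Some \<circ> \<alpha>) x = Some True" if "lit_val \<phi> x = Some True" for x
    using that by (cases x) (auto simp: \<alpha>_def)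
  with \<phi> have "models \<alpha> F"
    unfolding models_def apply_pa_eq_empty_iff by blast
  then show "\<exists>\<alpha>. models \<alpha> F" by blast
next
  assume "\<exists>\<alpha>. models \<alpha> F"
  then obtain \<alpha> where \<alpha>: "models \<alpha> F" by blast
  define \<phi> where "\<phi> = (Some \<circ> \<alpha>) |` vars F"
  have "lit_val \<phi> x = lit_val (Some \<circ> \<alpha>) x" if "C \<in> F" "x \<in> C" for C x
    by (rule lit_val_cong) (use that in \<open>auto simp: \<phi>_def vars_def restrict_map_def\<close>)
  with \<alpha> have "\<phi> \<star> F = {}"
    unfolding models_def apply_pa_eq_empty_iff by metis
  moreover have "is_passign \<phi>"
    using assms unfolding is_passign_def \<phi>_def by (simp add: dom_def restrict_map_def)
  ultimately show "satisfiable F"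
    unfolding satisfiable_def by blast
qed

lemma finite_vars_apply_pa: "finite (vars F) \<Longrightarrow> finite (vars (\<phi> \<star> F))"
  using vars_apply_pa[of \<phi> F] by (meson finite_Diff finite_subset)

lemma satisfiable_assign_iff:
  assumes "finite (vars F)"
  shows "satisfiable ([v \<mapsto> b] \<star> F) \<longleftrightarrow> (\<exists>\<alpha>. models \<alpha> F \<and> \<alpha> v = b)"
proof -
  have "\<exists>\<beta>. models \<beta> F \<and> \<beta> v = b" if "models (\<alpha>(v := b)) F" for \<alpha>
    using that by (intro exI[of _ "\<alpha>(v := b)"]) simp
  moreover have "models (\<alpha>(v := b)) F" if "models \<alpha> F" "\<alpha> v = b" for \<alpha>
    using that by (simp add: fun_upd_idem)
  ultimately show ?thesis
    unfolding satisfiable_iff_models[OF finite_vars_apply_pa[OF assms]] models_assign by blast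
qed

lemma forced_iff:
  assumes "finite (vars F)"
  shows "forced F (Pos v) \<longleftrightarrow> (\<forall>\<alpha>. models \<alpha> F \<longrightarrow> \<alpha> v)"
    and "forced F (Neg v) \<longleftrightarrow> (\<forall>\<alpha>. models \<alpha> F \<longrightarrow> \<not> \<alpha> v)"
  unfolding forced_def using satisfiable_assign_iff[OF assms] by auto

text \<open>For finite \<open>vars F\<close> this means that \<open>F\<close> is satisfiable and has
  no forced literal.\<close>

definition flexible :: "'v clause set \<Rightarrow> bool" where
  "flexible F \<longleftrightarrow> (\<forall>v b. \<exists>\<alpha>. models \<alpha> F \<and> \<alpha> v = b)"

section \<open>Generalised unit propagation as a refutation calculus\<close>

text \<open>The derivations abstract from the choices made by \<^const>\<open>gup\<close>.\<close>

inductive refutable :: "nat \<Rightarrow> 'v clause set \<Rightarrow> bool" where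
  empty_clause: "{} \<in> F \<Longrightarrow> refutable k F"
| branch: "refutable k ([v \<mapsto> b] \<star> F) \<Longrightarrow> refutable (Suc k) ([v \<mapsto> \<not> b] \<star> F) \<Longrightarrow> refutable (Suc k) F"

lemma refutable_0_iff: "refutable 0 F \<longleftrightarrow> {} \<in> F"
  by (auto intro: empty_clause elim: refutable.cases)

lemma refutable_Suc: "refutable k F \<Longrightarrow> refutable (Suc k) F"
proof (induction rule: refutable.induct)
  case (branch k v b F)
  from branch.IH show ?case
    by (rule refutable.branch)
qed (rule empty_clause)

lemma refutable_mono: "refutable k F \<Longrightarrow> F \<subseteq> G \<Longrightarrow> refutable k G"
proof (induction arbitrary: G rule: refutable.induct)
  case (branch k v b F)
  note subset = apply_pa_mono[OF branch.prems]
  show ?case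
    by (rule refutable.branch[OF branch.IH(1)[OF subset] branch.IH(2)[OF subset]])
next
  case (empty_clause F k)
  then show ?case
    by (intro refutable.empty_clause) (rule subsetD)
qed

lemma refutable_apply_pa: "refutable k F \<Longrightarrow> refutable k (\<phi> \<star> F)"
proof (induction arbitrary: \<phi> rule: refutable.induct)
  case (empty_clause F k)
  then show ?case
    by (simp add: refutable.empty_clause empty_clause_in_apply_pa)
next
  case (branch k v b F)
  show ?case
  proof (cases "\<phi> v")
    case None
    then have "\<phi> ++ [v \<mapsto> c] = [v \<mapsto> c] ++ \<phi>" for c
      by (auto simp: map_add_def split: option.splits)
    then have "\<phi> \<star> ([v \<mapsto> c] \<star> F) = [v \<mapsto> c] \<star> (\<phi> \<star> F)" for c
      by (simp only: apply_pa_apply_pa)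
    with branch.IH[of \<phi>] show ?thesis
      by (metis refutable.branch)
  next
    case (Some c)
    then have "\<phi> ++ [v \<mapsto> c] = \<phi>"
      by (auto simp: map_add_def)
    then have "\<phi> \<star> ([v \<mapsto> c] \<star> F) = \<phi> \<star> F"
      by (simp only: apply_pa_apply_pa)
    \<comment> \<open>The branch agreeing with \<open>\<phi>\<close> already refutes
      \<open>\<phi> \<star> F\<close>. If it is the cheaper branch, its refutation is lifted by one
      level.\<close>
    then show ?thesis
      using branch.IH[of \<phi>] by (cases "c = b") (auto intro: refutable_Suc)
  qed
qed

text \<open>Soundness of the calculus: every total assignment agrees with one of the two
  branches.\<close>

lemma refutable_not_models: "refutable k F \<Longrightarrow> \<not> models \<alpha> F"
proof (induction arbitrary: \<alpha> rule: refutable.induct)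
  case (branch k v b F)
  have "\<alpha>(v := b) = \<alpha> \<or> \<alpha>(v := \<not> b) = \<alpha>"
    by (cases "\<alpha> v = b") (auto simp: fun_upd_idem)
  then show ?case
    using branch.IH[of \<alpha>] by (auto simp: models_assign)
qed (rule not_models_empty_clause)

section \<open>Agreement of \<open>gup\<close> with the calculus\<close>

lemma card_vars_assign_less:
  assumes "finite (vars F)" and "v \<in> vars F"
  shows "card (vars ([v \<mapsto> b] \<star> F)) < card (vars F)"
  by (rule psubset_card_mono) (use assms vars_apply_pa[of "[v \<mapsto> b]" F] in auto)

lemma apply_pa_assign_idle: "v \<notin> vars F \<Longrightarrow> [v \<mapsto> b] \<star> F = F"
  by (rule apply_pa_disjoint) auto

text \<open>Hides the literal picked by \<open>SOME\<close> behind an unspecified failing pair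
  \<open>v\<close>, \<open>b\<close>, so that later arguments cannot depend on the choice. That
  \<open>v\<close> occurs in \<open>F\<close> allows induction on the number of variables.\<close>

lemma gup_Suc_cases:
  assumes "finite (vars F)"
  obtains (empty) "gup k F = {{}}" "gup (Suc k) F = {{}}"
  | (propagate) v b where "gup k F \<noteq> {{}}" "gup k ([v \<mapsto> b] \<star> F) = {{}}" "v \<in> vars F"
      "gup (Suc k) F = gup (Suc k) ([v \<mapsto> \<not> b] \<star> F)"
  | (stable) "gup k F \<noteq> {{}}" "\<And>v b. gup k ([v \<mapsto> b] \<star> F) \<noteq> {{}}" "gup (Suc k) F = F"
proof -
  consider "gup k F = {{}}"
    | "gup k F \<noteq> {{}}" "\<exists>x. gup k (set_lit x False \<star> F) = {{}}"
    | "gup k F \<noteq> {{}}" "\<nexists>x. gup k (set_lit x False \<star> F) = {{}}"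
    by blast
  then show ?thesis
  proof cases
    case 1
    then have "gup (Suc k) F = {{}}"
      by (subst gup_Suc_unfold) simp
    with 1 show ?thesis
      by (rule empty)
  next
    case 2
    define x where "x = (SOME x. gup k (set_lit x False \<star> F) = {{}})"
    have x: "gup k (set_lit x False \<star> F) = {{}}"
      unfolding x_def by (rule someI_ex) (rule 2(2))
    obtain v b where vb: "set_lit x False = [v \<mapsto> b]" "set_lit x True = [v \<mapsto> \<not> b]"
      by (rule set_lit_cases)
    have "gup (Suc k) F = gup (Suc k) (set_lit x True \<star> F)"
      unfolding x_def by (subst gup_Suc_unfold) (simp only: 2 if_False if_True)
    \<comment> \<open>Otherwise the assignment would leave \<open>F\<close> unchanged, and
      \<open>gup k F\<close> would already be \<open>{{}}\<close>.\<close>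
    moreover have "v \<in> vars F"
      using x 2(1) apply_pa_assign_idle[of v F b] vb by auto
    ultimately show ?thesis
      using propagate[of v b] x vb 2(1) by simp
  next
    case 3
    then have "gup (Suc k) F = F"
      by (subst gup_Suc_unfold) (simp only: if_False)
    moreover have "gup k ([v \<mapsto> b] \<star> F) \<noteq> {{}}" for v b
      using 3(2) ex_set_lit_False_iff[of "\<lambda>\<phi>. gup k (\<phi> \<star> F) = {{}}"] by blast
    ultimately show ?thesis
      using stable 3(1) by blast
  qed
qed

text \<open>Induction on \<open>k\<close> and, within each level, on the number of variables. The
  choice of the propagated literal is harmless because refutability at level \<open>Suc k\<close>
  survives every assignment.\<close>

lemma gup_eq_empty_clause_iff:
  "finite (vars F) \<Longrightarrow> gup k F = {{}} \<longleftrightarrow> refutable k F"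
proof (induction k arbitrary: F)
  case 0
  then show ?case
    by (auto simp: refutable_0_iff)
next
  case (Suc k)
  note outer = Suc.IH
  show ?case
    using Suc.prems
  proof (induction "card (vars F)" arbitrary: F rule: less_induct)
    case less
    note IH = outer[OF less.prems] outer[OF finite_vars_apply_pa[OF less.prems]]
    from less.prems show ?case
    proof (cases rule: gup_Suc_cases[where k = k])
      case empty
      then show ?thesis
        using IH(1) refutable_Suc[of k F] by blast
    next
      case (propagate v b)
      have "gup (Suc k) ([v \<mapsto> \<not> b] \<star> F) = {{}} \<longleftrightarrow> refutable (Suc k) ([v \<mapsto> \<not> b] \<star> F)"
        by (rule less.hyps[OF card_vars_assign_less[OF less.prems propagate(3)]
              finite_vars_apply_pa[OF less.prems]])
      then show ?thesis
        using propagate(2,4) IH(2)[of "[v \<mapsto> b]"] refutable.branch[of k v b F]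
          refutable_apply_pa[of "Suc k" F "[v \<mapsto> \<not> b]"] by metis
    next
      case stable
      have "\<not> refutable k F"
        using stable(1) IH(1) by simp
      moreover have "\<not> refutable k ([v \<mapsto> b] \<star> F)" for v b
        using stable(2) IH(2) by simp
      ultimately have "\<not> refutable (Suc k) F"
        using refutable.cases[of "Suc k" F] empty_clause[of F k] by (metis nat.inject)
      moreover have "F \<noteq> {{}}"
        using stable(1) IH(1) empty_clause[of F k] by auto
      ultimately show ?thesis
        using stable(3) by simp
    qed
  qed
qed

section \<open>Propagation completeness via stable clause-sets\<close>

text \<open>Expresses that \<open>gup k\<close> makes no progress, without mentioning
  \<open>gup\<close>. For \<open>k = 0\<close> only the absence of the empty clause remains. For
  \<open>k = Suc j\<close>, non-refutability of \<open>F\<close> at level \<open>j\<close> is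
  implied, since refutations survive assignments.\<close>

definition stable :: "nat \<Rightarrow> 'v clause set \<Rightarrow> bool" where
  "stable k F \<longleftrightarrow> {} \<notin> F \<and> (\<forall>j v b. k = Suc j \<longrightarrow> \<not> refutable j ([v \<mapsto> b] \<star> F))"

lemma stable_subset:
  assumes "stable k G" and "F \<subseteq> G"
  shows "stable k F"
proof -
  have "\<not> refutable j ([v \<mapsto> b] \<star> F)" if "k = Suc j" for j v b
    using assms(1) that refutable_mono[OF _ apply_pa_mono[OF assms(2)], of j "[v \<mapsto> b]"]
    by (auto simp: stable_def)
  moreover have "{} \<notin> F"
    using assms by (auto simp: stable_def)
  ultimately show ?thesis
    by (simp add: stable_def)
qed

lemma gup_stable:
  assumes "finite (vars F)" and "stable k F"
  shows "gup k F = F"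
proof (cases k)
  case 0
  then show ?thesis
    using assms(2) by (simp add: stable_def)
next
  case (Suc j)
  have *: "\<not> refutable j ([v \<mapsto> b] \<star> F)" for v b
    using assms(2) Suc by (simp add: stable_def)
  note iff = gup_eq_empty_clause_iff[OF finite_vars_apply_pa[OF assms(1)]]
  from assms(1) show ?thesis
  proof (cases rule: gup_Suc_cases[where k = j])
    case empty
    then show ?thesis
      \<comment> \<open>Any assignment of one variable would do here: a refutation of
        \<open>F\<close> would survive it, contrary to stability.\<close>
      using * refutable_apply_pa[of j F "[undefined \<mapsto> True]"]
        gup_eq_empty_clause_iff[OF assms(1)] by blast
  next
    case (propagate v b)
    then show ?thesis
      using * by (simp add: iff)
  qed (simp add: Suc)
qed

text \<open>By soundness, a propagation step sets a variable to the value that it has in all models,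
  so that \<open>gup_inf\<close> can follow the step.\<close>

lemma gup_not_stable:
  assumes "finite (vars F)" and "\<not> stable k F"
  obtains "gup k F = {{}}"
  | v b where "v \<in> vars F" "\<And>\<alpha>. models \<alpha> F \<Longrightarrow> \<alpha> v = b" "gup k F = gup k ([v \<mapsto> b] \<star> F)"
proof (cases "{} \<in> F")
  case True
  then show ?thesis
    using that(1) gup_eq_empty_clause_iff[OF assms(1)] empty_clause by blast
next
  case False
  \<comment> \<open>Without the empty clause, only a failing assignment can violate stability, so
    \<open>k\<close> is a successor.\<close>
  then obtain j v b where k: "k = Suc j" and ref: "refutable j ([v \<mapsto> b] \<star> F)"
    using assms(2) unfolding stable_def by blast
  note iff = gup_eq_empty_clause_iff[OF finite_vars_apply_pa[OF assms(1)]]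
  from assms(1) show ?thesis
  proof (cases rule: gup_Suc_cases[where k = j])
    case empty
    then show ?thesis
      using that(1) k by simp
  next
    case (propagate w c)
    have "\<alpha> w = (\<not> c)" if "models \<alpha> F" for \<alpha>
    proof -
      have "\<not> models \<alpha> ([w \<mapsto> c] \<star> F)"
        using propagate(2) by (simp add: iff refutable_not_models)
      moreover have "models \<alpha> ([w \<mapsto> c] \<star> F)" if "\<alpha> w = c"
        using that \<open>models \<alpha> F\<close> by (simp add: models_assign fun_upd_idem)
      ultimately show ?thesis by blast
    qed
    then show ?thesis
      using propagate(3,4) k by (intro that(2)[of w "\<not> c"]) simp_all
  next
    case stable
    then show ?thesis
      using ref by (simp add: iff)
  qed
qed

text \<open>The assignment merely releases the value at \<open>v\<close> in the models of
  \<open>F\<close>. Hence the forced literals on other variables stay the same, and composition with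
  \<open>[v \<mapsto> b]\<close> restores the one on \<open>v\<close>.\<close>

lemma gup_inf_assign:
  assumes fin: "finite (vars F)" and forced: "\<And>\<alpha>. models \<alpha> F \<Longrightarrow> \<alpha> v = b"
  shows "gup_inf ([v \<mapsto> b] \<star> F) = gup_inf F"
proof -
  note fin' = finite_vars_apply_pa[OF fin, of "[v \<mapsto> b]"]
  have sat: "satisfiable ([v \<mapsto> b] \<star> F) \<longleftrightarrow> satisfiable F"
    unfolding satisfiable_assign_iff[OF fin] satisfiable_iff_models[OF fin] using forced by blast
  show ?thesis
  proof (cases "satisfiable F")
    case True
    then obtain \<alpha> where \<alpha>: "models \<alpha> F" "\<alpha> v = b"
      using forced satisfiable_iff_models[OF fin] by blast
    \<comment> \<open>\<open>P\<close> is later instantiated with the identity and with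
      \<open>Not\<close>, for the two signs of a literal.\<close>
    have all: "(\<forall>\<beta>. models \<beta> ([v \<mapsto> b] \<star> F) \<longrightarrow> P (\<beta> w)) \<longleftrightarrow> (\<forall>\<beta>. models \<beta> F \<longrightarrow> P (\<beta> w))"
      if "w \<noteq> v" for w P
    proof (intro iffI allI impI)
      fix \<beta>
      assume *: "\<forall>\<beta>. models \<beta> ([v \<mapsto> b] \<star> F) \<longrightarrow> P (\<beta> w)" and \<beta>: "models \<beta> F"
      from \<beta> have "models \<beta> ([v \<mapsto> b] \<star> F)"
        using forced by (simp add: models_assign fun_upd_idem)
      with * show "P (\<beta> w)" by blast
    next
      fix \<beta>
      assume *: "\<forall>\<beta>. models \<beta> F \<longrightarrow> P (\<beta> w)" and "models \<beta> ([v \<mapsto> b] \<star> F)"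
      then have "P ((\<beta>(v := b)) w)"
        unfolding models_assign by blast
      then show "P (\<beta> w)"
        using that by simp
    qed
    have "forced ([v \<mapsto> b] \<star> F) (Pos w) = forced F (Pos w)"
      "forced ([v \<mapsto> b] \<star> F) (Neg w) = forced F (Neg w)" if "w \<noteq> v" for w
      unfolding forced_iff[OF fin] forced_iff[OF fin']
      by (rule all[OF that, of "\<lambda>x. x"], rule all[OF that, of Not])
    then have "forced_assignment ([v \<mapsto> b] \<star> F) w = forced_assignment F w" if "w \<noteq> v" for w
      using that by (simp add: forced_assignment_def)
    moreover have "forced_assignment F v = Some b"
      using \<alpha> forced unfolding forced_assignment_def forced_iff[OF fin] by auto
    ultimately have "forced_assignment ([v \<mapsto> b] \<star> F) ++ [v \<mapsto> b] = forced_assignment F"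
      by auto
    then show ?thesis
      using True sat by (simp add: gup_inf_def apply_pa_apply_pa)
  qed (simp add: sat gup_inf_def)
qed

lemma gup_inf_flexible:
  assumes "finite (vars F)" and "flexible F"
  shows "gup_inf F = F"
proof -
  have ex: "\<exists>\<alpha>. models \<alpha> F \<and> \<alpha> v = b" for v b
    using assms(2) by (simp add: flexible_def)
  have "\<not> forced F (Pos v)" "\<not> forced F (Neg v)" for v
    using ex[of v False] ex[of v True] unfolding forced_iff[OF assms(1)] by auto
  then have "forced_assignment F = Map.empty"
    by (simp add: forced_assignment_def)
  moreover have "satisfiable F"
    using ex satisfiable_iff_models[OF assms(1)] by blast
  ultimately show ?thesis
    by (simp add: gup_inf_def apply_pa_disjoint)
qed

text \<open>Applying an assignment removes its domain from the variables, so at a fixed point no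
  variable of \<open>F\<close> is forced. All other variables can be changed freely in a
  model.\<close>

lemma flexible_if_gup_inf_eq:
  assumes fin: "finite (vars F)" and "{} \<notin> F" and eq: "gup_inf F = F"
  shows "flexible F"
proof -
  \<comment> \<open>\<open>{} \<notin> F\<close> excludes \<open>{{}}\<close>, the value of
    \<open>gup_inf\<close> on unsatisfiable clause-sets.\<close>
  have sat: "satisfiable F" and fa: "forced_assignment F \<star> F = F"
    using assms(2) eq unfolding gup_inf_def by (auto split: if_splits)
  obtain \<alpha> where \<alpha>: "models \<alpha> F"
    using sat satisfiable_iff_models[OF fin] by blast
  have "\<exists>\<beta>. models \<beta> F \<and> \<beta> v = b" for v b
  proof (cases "v \<in> vars F")
    case False
    then have "models (\<alpha>(v := b)) F"
      using \<alpha> by (subst models_cong[of F _ \<alpha>]) auto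
    then show ?thesis
      by (intro exI[of _ "\<alpha>(v := b)"]) simp
  next
    case True
    then have "forced_assignment F v = None"
      using vars_apply_pa[of "forced_assignment F" F] fa by auto
    then show ?thesis
      unfolding forced_assignment_def forced_iff[OF fin] by (cases b) (auto split: if_splits)
  qed
  then show ?thesis
    unfolding flexible_def by blast
qed

text \<open>On a stable clause-set \<open>gup k\<close> is the identity, so agreement with
  \<open>gup_inf\<close> there amounts to flexibility. Elsewhere \<open>gup k\<close> either refutes
  or propagates a forced value; the latter preserves \<open>gup_inf\<close> and removes a variable,
  which allows induction.\<close>

theorem PC_iff_stable_flexible:
  "F \<in> PC k \<longleftrightarrow> is_clause_set F \<and>
     (\<forall>\<phi>. is_passign \<phi> \<longrightarrow> stable k (\<phi> \<star> F) \<longrightarrow> flexible (\<phi> \<star> F))"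
proof (cases "is_clause_set F")
  case True
  have fin: "finite (vars (\<phi> \<star> F))" for \<phi>
    by (rule finite_vars_apply_pa[OF finite_vars[OF True]])
  have "flexible (\<phi> \<star> F)"
    if "stable k (\<phi> \<star> F)" "gup k (\<phi> \<star> F) = gup_inf (\<phi> \<star> F)" for \<phi>
    using that gup_stable[OF fin that(1)] flexible_if_gup_inf_eq[OF fin]
    unfolding stable_def by metis
  moreover have "gup k (\<phi> \<star> F) = gup_inf (\<phi> \<star> F)"
    if *: "\<And>\<phi>. is_passign \<phi> \<Longrightarrow> stable k (\<phi> \<star> F) \<Longrightarrow> flexible (\<phi> \<star> F)" and "is_passign \<phi>" for \<phi>
    using that(2)
  proof (induction "card (vars (\<phi> \<star> F))" arbitrary: \<phi> rule: less_induct)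
    case less
    show ?case
    proof (cases "stable k (\<phi> \<star> F)")
      case True
      then show ?thesis
        using gup_stable[OF fin] gup_inf_flexible[OF fin] *[OF less.prems] by simp
    next
      case False
      from fin False show ?thesis
      proof (cases rule: gup_not_stable)
        case 1
        then have "refutable k (\<phi> \<star> F)"
          unfolding gup_eq_empty_clause_iff[OF fin] .
        then have "\<not> satisfiable (\<phi> \<star> F)"
          unfolding satisfiable_iff_models[OF fin] by (simp add: refutable_not_models)
        then show ?thesis
          using 1 by (simp add: gup_inf_def)
      next
        case (2 v b)
        have "gup k ([v \<mapsto> b] \<star> \<phi> \<star> F) = gup_inf ([v \<mapsto> b] \<star> \<phi> \<star> F)"
          unfolding apply_pa_apply_pa
        proof (rule less.hyps)
          show "card (vars (([v \<mapsto> b] ++ \<phi>) \<star> F)) < card (vars (\<phi> \<star> F))"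
            using card_vars_assign_less[OF fin 2(1)] by (simp add: apply_pa_apply_pa)
          show "is_passign ([v \<mapsto> b] ++ \<phi>)"
            using less.prems by (simp add: is_passign_def)
        qed
        then show ?thesis
          using 2(3) gup_inf_assign[OF fin 2(2)] by simp
      qed
    qed
  qed
  ultimately show ?thesis
    using True unfolding PC_def by auto
qed (simp add: PC_def)

section \<open>Acyclic families\<close>

text \<open>A longest path closes up: all neighbours of its first vertex lie on it.\<close>

lemma ex_cycle_if_min_degree_2:
  assumes fin: "finite V" and "V \<noteq> {}" and sub: "V \<subseteq> fst G"
    and loopfree: "\<And>x. {x, x} \<notin> snd G"
    and deg: "\<And>x y. x \<in> V \<Longrightarrow> \<exists>z\<in>V. z \<noteq> y \<and> {x, z} \<in> snd G"
  shows "\<exists>p. is_cycle G p"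
proof -
  define path where "path p \<longleftrightarrow> p \<noteq> [] \<and> distinct p \<and> set p \<subseteq> V \<and>
    (\<forall>j. Suc j < length p \<longrightarrow> {p ! j, p ! Suc j} \<in> snd G)" for p
  obtain x where "x \<in> V" using \<open>V \<noteq> {}\<close> by blast
  then have ex: "path [x]"
    by (simp add: path_def)
  have bound: "length p < Suc (card V)" if "path p" for p
    using that fin unfolding path_def by (metis card_mono distinct_card le_imp_less_Suc)
  obtain p where p: "path p" and max: "\<And>q. path q \<Longrightarrow> length q \<le> length p"
    using ex_has_greatest_nat[of path "[x]" length "Suc (card V)"] ex bound by metis
  have p0: "p ! 0 \<in> V"
    using p unfolding path_def by (cases p) auto
  have neighbour: "z \<in> set p" if z: "z \<in> V" "{p ! 0, z} \<in> snd G" for z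
  proof (rule ccontr)
    assume "z \<notin> set p"
    moreover have "{(z # p) ! j, (z # p) ! Suc j} \<in> snd G" if "Suc j < length (z # p)" for j
      using that p z(2) by (cases j) (auto simp: path_def insert_commute)
    ultimately have "path (z # p)"
      using p z(1) by (auto simp: path_def)
    then show False
      using max by force
  qed
  \<comment> \<open>If \<open>p\<close> has a single vertex, then \<open>p ! 1\<close> is
    unspecified; that case still fails, since \<open>z\<close> would be \<open>p ! 0\<close> and
    form a loop.\<close>
  obtain z where z: "z \<in> V" "z \<noteq> p ! 1" "{p ! 0, z} \<in> snd G"
    using deg[OF p0] by blast
  obtain j where j: "j < length p" "z = p ! j"
    using neighbour[OF z(1,3)] by (metis in_set_conv_nth)
  have "j \<noteq> 0"
    using z(3) j loopfree by metis
  moreover have "j \<noteq> 1"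
    using z(2) j by auto
  ultimately have "2 \<le> j" by simp
  \<comment> \<open>The cycle is the initial segment of \<open>p\<close> ending in \<open>z\<close>,
    closed by the edge from \<open>z\<close> to \<open>p ! 0\<close>; \<open>2 \<le> j\<close> gives
    it at least three vertices.\<close>
  let ?q = "take (Suc j) p"
  have len: "length ?q = Suc j"
    using j(1) by simp
  have "{?q ! i, ?q ! (Suc i mod length ?q)} \<in> snd G" if "i < length ?q" for i
  proof (cases "i = j")
    case True
    then show ?thesis
      using z(3) j len by (simp add: insert_commute)
  next
    case False
    then have "i < j"
      using that len by simp
    then show ?thesis
      using p j len by (simp add: path_def)
  qed
  moreover have "distinct ?q" "set ?q \<subseteq> fst G"
    using p sub set_take_subset[of "Suc j" p] unfolding path_def by auto
  ultimately have "is_cycle G ?q"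
    using \<open>2 \<le> j\<close> len unfolding is_cycle_def by auto
  then show ?thesis ..
qed

section \<open>Leaves of acyclic families\<close>

lemma acyclic_family_mono:
  assumes "acyclic_family I F" and "J \<subseteq> I" and "\<And>i. i \<in> J \<Longrightarrow> vars (G i) \<subseteq> vars (F i)"
  shows "acyclic_family J G"
proof -
  have "fst (incidence_graph J G) \<subseteq> fst (incidence_graph I F)"
    "snd (incidence_graph J G) \<subseteq> snd (incidence_graph I F)"
    using assms(2,3) unfolding incidence_graph_def by (simp, blast)+
  then have "is_cycle (incidence_graph I F) p" if "is_cycle (incidence_graph J G) p" for p
    using that unfolding is_cycle_def by blast
  then show ?thesis
    using assms(1) unfolding acyclic_family_def by blast
qed

text \<open>Otherwise the subgraph on all indices and the shared variables has minimum degree two: a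
  shared variable lies in two members, and each member has two shared variables.\<close>

lemma acyclic_family_ex_leaf:
  assumes "finite I" and "I \<noteq> {}" and fin: "\<And>i. i \<in> I \<Longrightarrow> finite (vars (F i))"
    and "acyclic_family I F"
  shows "\<exists>i\<in>I. \<exists>w. vars (F i) \<inter> vars (\<Union>j\<in>I - {i}. F j) \<subseteq> {w}"
proof (rule ccontr)
  assume no_leaf: "\<not> ?thesis"
  define S where "S = {v. \<exists>i\<in>I. \<exists>j\<in>I. i \<noteq> j \<and> v \<in> vars (F i) \<and> v \<in> vars (F j)}"
  define V where "V = Inl ` S \<union> Inr ` I"
  have S: "S \<subseteq> (\<Union>i\<in>I. vars (F i))"
    unfolding S_def by blast
  have "\<exists>p. is_cycle (incidence_graph I F) p"
  proof (rule ex_cycle_if_min_degree_2)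
    show "finite V"
      using S assms(1) fin unfolding V_def by (meson finite_UN_I finite_UnI finite_imageI finite_subset)
    show "V \<noteq> {}"
      using assms(2) by (simp add: V_def)
    show "V \<subseteq> fst (incidence_graph I F)"
      using S unfolding V_def incidence_graph_def by auto
    show "{x, x} \<notin> snd (incidence_graph I F)" for x
      unfolding incidence_graph_def by auto
    show "\<exists>z\<in>V. z \<noteq> y \<and> {x, z} \<in> snd (incidence_graph I F)" if "x \<in> V" for x y
    proof (cases x)
      case (Inl v)
      then have "v \<in> S"
        using that by (auto simp: V_def)
      then obtain i j where "i \<in> I" "j \<in> I" "i \<noteq> j" "v \<in> vars (F i)" "v \<in> vars (F j)"
        unfolding S_def by blast
      then obtain i where "i \<in> I" "v \<in> vars (F i)" "Inr i \<noteq> y"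
        by (cases "y = Inr i") auto
      then show ?thesis
        using Inl unfolding incidence_graph_def V_def by (intro bexI[of _ "Inr i"]) auto
    next
      case (Inr i)
      then have "i \<in> I"
        using that by (auto simp: V_def)
      with no_leaf have "\<not> vars (F i) \<inter> vars (\<Union>j\<in>I - {i}. F j) \<subseteq> {w}" for w
        by blast
      \<comment> \<open>If \<open>y\<close> is a variable vertex, its variable is avoided. If
        \<open>y\<close> is an index, \<open>projl y\<close> is unspecified, but then
        \<open>Inl v\<close> differs from \<open>y\<close> anyway.\<close>
      from this[of "projl y"] obtain v
        where v: "v \<in> vars (F i)" "v \<in> vars (\<Union>j\<in>I - {i}. F j)" "v \<noteq> projl y"
        by blast
      from v(3) have "Inl v \<noteq> y"
        by auto
      moreover have "v \<in> S"
        using v(1,2) \<open>i \<in> I\<close> unfolding S_def vars_UN by blast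
      ultimately show ?thesis
        using v Inr \<open>i \<in> I\<close> unfolding incidence_graph_def V_def
        by (intro bexI[of _ "Inl v"]) (auto simp: insert_commute)
    qed
  qed
  then show False
    using assms(4) unfolding acyclic_family_def by blast
qed

section \<open>Gluing models of flexible clause-sets\<close>

lemma flexible_Un:
  assumes F: "flexible F" and G: "flexible G" and shared: "vars F \<inter> vars G \<subseteq> {w}"
  shows "flexible (F \<union> G)"
proof -
  \<comment> \<open>First a model of \<open>F\<close> with the wanted value at \<open>v\<close> is
    chosen, then a model of \<open>G\<close> agreeing with it at \<open>w\<close>. The condition on
    \<open>v\<close> ensures that the second choice does not spoil the value at \<open>v\<close>.
    Local \<open>F\<close> and \<open>G\<close> allow both orders.\<close>
  have glue: "\<exists>\<gamma>. models \<gamma> (F \<union> G) \<and> \<gamma> v = b"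
    if F: "flexible F" and G: "flexible G" and shared: "vars F \<inter> vars G \<subseteq> {w}" and v: "v \<notin> vars G - {w}"
    for F G :: "'a clause set" and v b
  proof -
    obtain \<alpha> where \<alpha>: "models \<alpha> F" "\<alpha> v = b"
      using F unfolding flexible_def by metis
    obtain \<beta> where \<beta>: "models \<beta> G" "\<beta> w = \<alpha> w"
      using G unfolding flexible_def by metis
    define \<gamma> where "\<gamma> u = (if u \<in> vars G then \<beta> u else \<alpha> u)" for u
    have "models \<gamma> F"
      using \<alpha>(1) by (subst models_cong[of F \<gamma> \<alpha>]) (use shared \<beta>(2) in \<open>auto simp: \<gamma>_def\<close>)
    moreover have "models \<gamma> G"
      using \<beta>(1) by (subst models_cong[of G \<gamma> \<beta>]) (auto simp: \<gamma>_def)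
    moreover have "\<gamma> v = b"
      using v \<alpha>(2) \<beta>(2) by (auto simp: \<gamma>_def)
    ultimately show ?thesis
      using models_UN[of \<gamma> "\<lambda>x. x" "{F, G}"] by auto
  qed
  show ?thesis
    unfolding flexible_def
  proof (intro allI)
    fix v b
    \<comment> \<open>Apart from \<open>w\<close>, a variable belongs to at most one side; the other
      side is the one to be adapted.\<close>
    have "v \<notin> vars G - {w} \<or> v \<notin> vars F - {w}"
      using shared by blast
    then show "\<exists>\<gamma>. models \<gamma> (F \<union> G) \<and> \<gamma> v = b"
      using glue[OF F G shared] glue[OF G F] shared by (metis Int_commute Un_commute)
  qed
qed

text \<open>A leaf is split off, and the remaining family is again acyclic. The empty union is
  flexible since every total assignment is a model of it.\<close>

lemma flexible_acyclic_UN: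
  assumes "finite I" and "\<And>i. i \<in> I \<Longrightarrow> finite (vars (F i))" and "acyclic_family I F"
    and "\<And>i. i \<in> I \<Longrightarrow> flexible (F i)"
  shows "flexible (\<Union>i\<in>I. F i)"
  using assms
proof (induction rule: finite_psubset_induct)
  case (psubset I)
  show ?case
  proof (cases "I = {}")
    case True
    then show ?thesis
      unfolding flexible_def models_def apply_pa_def by auto
  next
    case False
    then obtain i w where i: "i \<in> I" and leaf: "vars (F i) \<inter> vars (\<Union>j\<in>I - {i}. F j) \<subseteq> {w}"
      using acyclic_family_ex_leaf[of I F] psubset by metis
    have "flexible (\<Union>j\<in>I - {i}. F j)"
      using i psubset.prems acyclic_family_mono[of I F "I - {i}" F] by (intro psubset.IH) auto
    then have "flexible (F i \<union> (\<Union>j\<in>I - {i}. F j))"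
      by (rule flexible_Un[OF psubset.prems(3)[OF i] _ leaf])
    moreover have "F i \<union> (\<Union>j\<in>I - {i}. F j) = (\<Union>i\<in>I. F i)"
      using i by blast
    ultimately show ?thesis by simp
  qed
qed

theorem theorem4p6:
  fixes k :: nat
    and I :: "'i set"
    and F :: "'i \<Rightarrow> 'v clause set"
  assumes "finite I"
    and "\<And>i. i \<in> I \<Longrightarrow> is_clause_set (F i)"
    and "acyclic_family I F"
    and "\<And>i. i \<in> I \<Longrightarrow> F i \<in> PC k"
  shows "(\<Union>i\<in>I. F i) \<in> PC k"
  unfolding PC_iff_stable_flexible
proof (intro conjI allI impI)
  show "is_clause_set (\<Union>i\<in>I. F i)"
    using assms(1,2) by (simp add: is_clause_set_def)
next
  fix \<phi> :: "'v \<rightharpoonup> bool"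
  assume \<phi>: "is_passign \<phi>" and stable: "stable k (\<phi> \<star> (\<Union>i\<in>I. F i))"
  have "flexible (\<Union>i\<in>I. \<phi> \<star> F i)"
  proof (rule flexible_acyclic_UN)
    show "acyclic_family I (\<lambda>i. \<phi> \<star> F i)"
      by (rule acyclic_family_mono[OF assms(3) subset_refl order_trans[OF vars_apply_pa Diff_subset]])
    fix i assume i: "i \<in> I"
    show "finite (vars (\<phi> \<star> F i))"
      by (rule finite_vars_apply_pa[OF finite_vars[OF assms(2)[OF i]]])
    \<comment> \<open>Lack of progress on the union passes to each member, where membership in
      \<open>PC k\<close> turns it into flexibility.\<close>
    have "stable k (\<phi> \<star> F i)"
      by (rule stable_subset[OF stable]) (use i in \<open>auto simp: apply_pa_UN\<close>)
    then show "flexible (\<phi> \<star> F i)"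
      using assms(4)[OF i] \<phi> by (simp add: PC_iff_stable_flexible)
  qed (rule assms(1))
  then show "flexible (\<phi> \<star> (\<Union>i\<in>I. F i))"
    by (simp add: apply_pa_UN)
qed

end
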